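(* Let $X$ be a real Banach space with dual $X^*$, and let $h:X\times X^*\to\mathbb{R}\cup\{\pm\infty\}$ be proper and convex, such that \[ h(x,x^* )\geq \langle x,x^*\rangle \quad\text{and}\quad h^*(x^*,x)\geq \langle x,x^*\rangle \qquad \forall (x,x^* )\in X\times X^*. \] If \[ \bigcup_{\lambda>0}\lambda\,\mathrm{Pr}_X\,\mathrm{D}(h) \] is a closed subspace of $X$, then the operator \[ T:=\{(x,x^* )\in X\times X^*\;|\; h^*(x^*,x)=\langle x,x^*\rangle\} \] is maximal monotone and $\mathcal{J}h\in\mathcal{F}_T$.
   Context: $\langle x,x^*\rangle=x^*(x)$ denotes the duality product $\pi(x,x^* )$. $X$ is identified with its canonical image in $X^{**}$. For $h$ on $X\times X^*$, its Fenchel conjugate is $h^*(x^*,x^{**})=\sup_{(x,y^* )\in X\times X^*}\langle x,x^*\rangle+\langle y^*,x^{**}\rangle-h(x,y^* )$, a function on $X^*\times X^{**}$; $h^*(x^*,x)$ means its value at $(x^*,x)$ with $x\in X\subset X^{**}$. $\mathcal{J}h(x,x^* ):=h^*(x^*,x)$ for $(x,x^* )\in X\times X^*$. $\mathrm{D}(h)=\{(x,x^* ): h(x,x^* )<\infty\}$ is the effective domain, $h$ is proper if $\mathrm{D}(h)\neq\emptyset$, and $\mathrm{Pr}_X\,\mathrm{D}(h)=\{x\in X:\exists x^*\in X^*,\ (x,x^* )\in \mathrm{D}(h)\}$. An operator $T\subset X\times X^*$ is monotone if $\langle x-y,x^*-y^*\rangle\ge0$ for all $(x,x^* ),(y,y^*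 )\in T$, and maximal monotone if it is monotone and not properly contained in any monotone operator. For maximal monotone $T$, the Fitzpatrick family $\mathcal{F}_T$ is the set of functions $g:X\times X^*\to\mathbb{R}\cup\{\pm\infty\}$ that are convex and lower semicontinuous (in the strong topology of $X\times X^*$), satisfy $g(x,x^* )\ge\langle x,x^*\rangle$ for all $(x,x^* )$, and satisfy $g(x,x^* )=\langle x,x^*\rangle$ whenever $(x,x^* )\in T$. *)

theory Defs
  imports "HOL-Analysis.Analysis"
begin

type_synonym 'a pt = "'a \<times> ('a \<Rightarrow>\<^sub>L real)"

definition pairing :: "'a::real_normed_vector pt \<Rightarrow> real" where
  "pairing p = blinfun_apply (snd p) (fst p)"

definition convex_fun :: "('b::real_vector \<Rightarrow> ereal) \<Rightarrow> bool" where
  "convex_fun g \<longleftrightarrow> convex {(p, t::real). g p \<le> ereal t}"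

definition lsc_fun :: "('b::topological_space \<Rightarrow> ereal) \<Rightarrow> bool" where
  "lsc_fun g \<longleftrightarrow> (\<forall>c::ereal. closed {p. g p \<le> c})"

definition effdom :: "('b \<Rightarrow> ereal) \<Rightarrow> 'b set" where
  "effdom g = {p. g p < \<infinity>}"

definition proper_fun :: "('b \<Rightarrow> ereal) \<Rightarrow> bool" where
  "proper_fun g \<longleftrightarrow> effdom g \<noteq> {}"

definition PrX :: "('a \<times> 'c) set \<Rightarrow> 'a set" where
  "PrX D = {x. \<exists>y. (x, y) \<in> D}"

text \<open>J h (x, x*) = h*(x*, x) = sup over (y,y*) of <y,x*> + <x,y*> - h(y,y*).\<close>
definition Jconj :: "('a::real_normed_vector pt \<Rightarrow> ereal) \<Rightarrow> 'a pt \<Rightarrow> ereal" where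
  "Jconj h p = (SUP q\<in>UNIV. ereal (blinfun_apply (snd p) (fst q) + blinfun_apply (snd q) (fst p)) - h q)"

definition monotone_op :: "'a::real_normed_vector pt set \<Rightarrow> bool" where
  "monotone_op T \<longleftrightarrow> (\<forall>(x, x') \<in> T. \<forall>(y, y') \<in> T. blinfun_apply (x' - y') (x - y) \<ge> 0)"

definition maximal_monotone :: "'a::real_normed_vector pt set \<Rightarrow> bool" where
  "maximal_monotone T \<longleftrightarrow> monotone_op T \<and> (\<forall>S. monotone_op S \<and> T \<subseteq> S \<longrightarrow> S = T)"

definition fitzpatrick_family :: "'a::real_normed_vector pt set \<Rightarrow> ('a pt \<Rightarrow> ereal) set" where
  "fitzpatrick_family T = {g. convex_fun g \<and> lsc_fun g \<and>
      (\<forall>p. g p \<ge> ereal (pairing p)) \<and> (\<forall>p\<in>T. g p = ereal (pairing p))}"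

end

theory Submission
  imports Defs
begin

text \<open>
  Translate a point \<open>(x0, x0')\<close> that is monotonically related to \<open>T\<close> to the origin. For any \<open>a\<close> in the
  projected domain of \<open>h\<close>, apply Fenchel duality to the translate of \<open>h\<close> and to half the sum of the squared
  norms of coordinates along \<open>x0\<close> and \<open>a\<close> and of values at these two vectors. The domain of the
  second function in the first variable is finite-dimensional, so the dual solution stays in
  \<open>X \<times> X*\<close> instead of \<open>X** \<times> X*\<close> and yields a point \<open>(x0 + x, x0' + x')\<close> of \<open>T\<close> with
  \<open>\<langle>x, x'\<rangle> = - (\<langle>x0, x'\<rangle>\<^sup>2 + \<langle>a, x'\<rangle>\<^sup>2)\<close>. Monotone relatedness forces both squares, hence also \<open>x\<close>, to
  vanish, so \<open>(x0, x0' + x')\<close> lies in \<open>T\<close>. Evaluating the inequality that expresses this at \<open>a\<close>,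
  where \<open>x'\<close> vanishes, gives the inequality for \<open>(x0, x0')\<close> at \<open>a\<close>; as \<open>a\<close> is arbitrary,
  \<open>(x0, x0')\<close> belongs to \<open>T\<close>. Exactness of the duality is where the closed subspace condition
  enters, through a Robinson--Ursescu argument for the closed epigraph of \<open>h\<close>. If \<open>x0\<close> lay outside that
  subspace, a functional separating it from the subspace could be added to points of \<open>T\<close> with any
  factor, contradicting monotone relatedness.
\<close>

subsection \<open>Hahn--Banach\<close>

text \<open>Homogeneity is stated as an inequality for positive factors because infima inherit it
  directly in this form; \<open>sublinear_scale\<close> recovers equality.\<close>

definition sublinear :: "('a::real_vector \<Rightarrow> real) \<Rightarrow> bool" where
  "sublinear p \<longleftrightarrow> (\<forall>x y. p (x + y) \<le> p x + p y) \<and> (\<forall>c>0. \<forall>x. p (c *\<^sub>R x) \<le> c * p x)"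

lemma sublinear_add: "sublinear p \<Longrightarrow> p (x + y) \<le> p x + p y"
  by (simp add: sublinear_def)

lemma sublinear_0:
  assumes "sublinear p" shows "p 0 = 0"
proof -
  have "p ((1/2) *\<^sub>R 0) \<le> (1/2) * p 0" "p (2 *\<^sub>R 0) \<le> 2 * p 0"
    using assms unfolding sublinear_def by (metis half_gt_zero zero_less_one, metis zero_less_numeral)
  then show ?thesis by simp
qed

lemma sublinear_scale:
  assumes "sublinear p" "0 \<le> c" shows "p (c *\<^sub>R x) = c * p x"
proof (cases "c = 0")
  case False
  then have c: "c > 0" using assms(2) by simp
  have "p (inverse c *\<^sub>R c *\<^sub>R x) \<le> inverse c * p (c *\<^sub>R x)"
    using assms(1) c unfolding sublinear_def by (metis inverse_positive_iff_positive)
  then have "c * p x \<le> p (c *\<^sub>R x)"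
    using c by (simp add: field_simps)
  then show ?thesis
    using assms(1) c by (simp add: sublinear_def antisym)
qed (use assms sublinear_0 in simp)

lemma sublinear_minus_le:
  assumes "sublinear p" shows "- p (- x) \<le> p x"
  using sublinear_add[OF assms, of x "- x"] sublinear_0[OF assms] by simp

text \<open>The index \<open>k\<close> may depend on the points involved, so the rule serves chains
  of functionals as well as families whose indices add up and scale.\<close>

lemma sublinear_INF:
  fixes F :: "'i \<Rightarrow> 'a::real_vector \<Rightarrow> real"
  assumes ne: "I \<noteq> {}"
    and bdd: "\<And>x. bdd_below ((\<lambda>i. F i x) ` I)"
    and add: "\<And>i j x y. i \<in> I \<Longrightarrow> j \<in> I \<Longrightarrow> \<exists>k\<in>I. F k (x + y) \<le> F i x + F j y"
    and scale: "\<And>i c x. i \<in> I \<Longrightarrow> 0 < c \<Longrightarrow> \<exists>k\<in>I. F k (c *\<^sub>R x) \<le> c * F i x"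
  shows "sublinear (\<lambda>x. INF i\<in>I. F i x)"
  unfolding sublinear_def
proof (intro conjI allI impI)
  fix x y
  have "(INF i\<in>I. F i (x + y)) \<le> F i x + F j y" if "i \<in> I" "j \<in> I" for i j
    using add[OF that, of x y] cINF_lower2[OF bdd] by blast
  then have "(INF i\<in>I. F i (x + y)) - F i x \<le> (INF j\<in>I. F j y)" if i: "i \<in> I" for i
    by (intro cINF_greatest[OF ne]) (use i in \<open>simp add: diff_le_eq add.commute[of _ "F i x"]\<close>)
  then have "(INF i\<in>I. F i (x + y)) - (INF j\<in>I. F j y) \<le> (INF i\<in>I. F i x)"
    by (intro cINF_greatest[OF ne]) (simp add: diff_le_eq add.commute)
  then show "(INF i\<in>I. F i (x + y)) \<le> (INF i\<in>I. F i x) + (INF i\<in>I. F i y)"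
    by simp
next
  fix c :: real and x assume c: "0 < c"
  have "(INF i\<in>I. F i (c *\<^sub>R x)) \<le> c * F i x" if "i \<in> I" for i
    using scale[OF that c, of x] cINF_lower2[OF bdd] by blast
  then have "(INF i\<in>I. F i (c *\<^sub>R x)) / c \<le> (INF i\<in>I. F i x)"
    using c by (intro cINF_greatest[OF ne]) (simp add: field_simps)
  then show "(INF i\<in>I. F i (c *\<^sub>R x)) \<le> c * (INF i\<in>I. F i x)"
    using c by (simp add: field_simps)
qed

text \<open>Lowering a sublinear functional along one direction again yields a sublinear functional.\<close>

lemma minimal_sublinear_linear:
  assumes q: "sublinear q"
    and min: "\<And>q'. sublinear q' \<Longrightarrow> q' \<le> q \<Longrightarrow> q' = q"
  shows "linear q"
proof -
  have super: "q x + q a \<le> q (x + a)" for x a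
  proof -
    \<comment> \<open>The infimum of \<open>F t\<close> over nonnegative \<open>t\<close> lies below
      \<open>q\<close>, as \<open>F 0\<close> is \<open>q\<close>. Minimality then makes it equal to
      \<open>q\<close>, and \<open>t = 1\<close> gives superadditivity.\<close>
    define F where "F t z = q (z + t *\<^sub>R a) - t * q a" for t z
    have bdd: "bdd_below ((\<lambda>t. F t z) ` {0..})" for z
    proof (rule bdd_belowI2)
      fix t :: real assume "t \<in> {0..}"
      then have "t * q a = q ((z + t *\<^sub>R a) + (- z))"
        by (simp add: sublinear_scale[OF q])
      also have "\<dots> \<le> q (z + t *\<^sub>R a) + q (- z)"
        by (rule sublinear_add[OF q])
      finally show "- q (- z) \<le> F t z" by (simp add: F_def)
    qed
    have "sublinear (\<lambda>z. INF t\<in>{0..}. F t z)"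
    proof (rule sublinear_INF[OF _ bdd])
      fix s t :: real and y z assume "s \<in> {0..}" "t \<in> {0..}"
      moreover have "F (s + t) (y + z) \<le> F s y + F t z"
        using sublinear_add[OF q, of "y + s *\<^sub>R a" "z + t *\<^sub>R a"]
        by (simp add: F_def algebra_simps)
      ultimately show "\<exists>k\<in>{0..}. F k (y + z) \<le> F s y + F t z"
        by (intro bexI[of _ "s + t"]) auto
    next
      fix t c :: real and z assume "t \<in> {0..}" "0 < c"
      moreover from this have "F (c * t) (c *\<^sub>R z) = c * F t z"
        using sublinear_scale[OF q, of c "z + t *\<^sub>R a"]
        by (simp add: F_def algebra_simps)
      ultimately show "\<exists>k\<in>{0..}. F k (c *\<^sub>R z) \<le> c * F t z"
        by (intro bexI[of _ "c * t"]) auto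
    qed simp
    moreover have "(\<lambda>z. INF t\<in>{0..}. F t z) \<le> q"
      using cINF_lower[OF bdd, of 0] by (auto simp: le_fun_def F_def)
    ultimately have "q x = (INF t\<in>{0..}. F t x)"
      using min by metis
    also have "\<dots> \<le> F 1 x" by (rule cINF_lower[OF bdd]) simp
    finally show ?thesis by (simp add: F_def)
  qed
  have add: "q (x + y) = q x + q y" for x y
    using super sublinear_add[OF q] by (simp add: antisym)
  have neg: "q (- x) = - q x" for x
    using add[of x "- x"] sublinear_0[OF q] by simp
  have "q (c *\<^sub>R x) = c * q x" for c x
  proof (cases "0 \<le> c")
    case False
    then show ?thesis
      using sublinear_scale[OF q, of "- c" x] neg[of "c *\<^sub>R x"] by simp
  qed (rule sublinear_scale[OF q])
  then show ?thesis using add by (intro linearI) auto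
qed

text \<open>Zorn's lemma for the reversed pointwise order yields a minimal sublinear functional
  below \<open>p\<close>, and minimal ones are linear. Chains are bounded by their pointwise infima,
  which \<open>- p (- x)\<close> keeps finite.\<close>

theorem hahn_banach_sublinear:
  fixes p :: "'a::real_vector \<Rightarrow> real"
  assumes p: "sublinear p"
  obtains f where "linear f" "\<And>x. f x \<le> p x"
proof -
  let ?A = "{q. sublinear q \<and> q \<le> p}"
  let ?R = "\<lambda>f g. g \<le> f"
  have "\<exists>m\<in>?A. \<forall>q\<in>?A. ?R m q \<longrightarrow> q = m"
  proof (rule predicate_Zorn)
    show "partial_order_on ?A (relation_of ?R ?A)"
      by (rule partial_order_on_relation_ofI) auto
    fix C assume "C \<in> Chains (relation_of ?R ?A)"
    then have CA: "C \<subseteq> ?A" and chain: "\<And>f g. f \<in> C \<Longrightarrow> g \<in> C \<Longrightarrow> f \<le> g \<or> g \<le> f"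
      by (auto simp: Chains_def relation_of_def)
    show "\<exists>u\<in>?A. \<forall>q\<in>C. ?R q u"
    proof (cases "C = {}")
      case False
      have bdd: "bdd_below ((\<lambda>q. q x) ` C)" for x
      proof (rule bdd_belowI2)
        fix q assume "q \<in> C"
        then have "sublinear q" "q (- x) \<le> p (- x)" using CA by (auto simp: le_fun_def)
        then show "- p (- x) \<le> q x" using sublinear_minus_le[of q x] by simp
      qed
      let ?g = "\<lambda>x. INF q\<in>C. q x"
      have "sublinear ?g"
      proof (rule sublinear_INF[OF False bdd])
        fix f g x y assume fg: "f \<in> C" "g \<in> C"
        have "\<exists>k\<in>C. k \<le> f \<and> k \<le> g" using chain[OF fg] fg by auto
        then obtain k where k: "k \<in> C" "k \<le> f" "k \<le> g" by blast
        then have "k (x + y) \<le> f x + g y"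
          using CA sublinear_add[of k x y] add_mono[of "k x" "f x" "k y" "g y"]
          by (auto simp: le_fun_def)
        then show "\<exists>k\<in>C. k (x + y) \<le> f x + g y" using k by blast
      next
        fix f :: "'a \<Rightarrow> real" and c x assume "f \<in> C" "(0::real) < c"
        then show "\<exists>k\<in>C. k (c *\<^sub>R x) \<le> c * f x"
          using CA by (auto simp: sublinear_def)
      qed
      moreover have le: "?g \<le> q" if "q \<in> C" for q
        using cINF_lower[OF bdd that] by (simp add: le_fun_def)
      moreover have "?g \<le> p" using le False CA by fastforce
      ultimately show ?thesis by blast
    qed (use p in auto)
  qed
  then obtain m where m: "sublinear m" "m \<le> p"
    and min: "\<And>q. sublinear q \<Longrightarrow> q \<le> p \<Longrightarrow> q \<le> m \<Longrightarrow> q = m" by auto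
  have "linear m"
    by (rule minimal_sublinear_linear[OF m(1)]) (use min m(2) order_trans in blast)
  then show thesis using that m(2) by (simp add: le_fun_def)
qed

section \<open>Linear minorants and separation from a closed subspace\<close>

text \<open>The infimum of \<open>l * t + K * norm (z - l *\<^sub>R u)\<close> over the cone
  generated by \<open>U\<close> is sublinear, and the growth condition on \<open>U\<close> keeps it
  finite. Any linear functional below it is as required.\<close>

lemma affine_minorant:
  fixes U :: "('a::real_normed_vector \<times> real) set"
  assumes U: "convex U" and K: "\<And>u t. (u, t) \<in> U \<Longrightarrow> - K * norm u \<le> t"
    and K0: "0 \<le> K"
  obtains f :: "'a \<Rightarrow>\<^sub>L real" where "\<And>u t. (u, t) \<in> U \<Longrightarrow> blinfun_apply f u \<le> t"
proof (cases "U = {}")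
  case False
  then obtain u0 t0 where U0: "(u0, t0) \<in> U" by auto
  define I where "I = {(l::real, u, t). 0 \<le> l \<and> (u, t) \<in> U}"
  define F :: "real \<times> 'a \<times> real \<Rightarrow> 'a \<Rightarrow> real" where "F = (\<lambda>(l, u, t) z. l * t + K * norm (z - l *\<^sub>R u))"
  have bdd: "bdd_below ((\<lambda>i. F i z) ` I)" for z
  proof (rule bdd_belowI2)
    fix i assume "i \<in> I"
    then obtain l u t where i: "i = (l, u, t)" "0 \<le> l" "(u, t) \<in> U" by (auto simp: I_def)
    have "norm (l *\<^sub>R u) \<le> norm z + norm (z - l *\<^sub>R u)"
      by (metis norm_minus_commute norm_triangle_sub)
    then have "K * (l * norm u) \<le> K * (norm z + norm (z - l *\<^sub>R u))"
      using i(2) by (intro mult_left_mono K0) simp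
    moreover have "- (l * (K * norm u)) \<le> l * t"
      using mult_left_mono[OF K[OF i(3)] i(2)] by simp
    ultimately show "- K * norm z \<le> F i z"
      by (simp add: i F_def algebra_simps)
  qed
  have "sublinear (\<lambda>z. INF i\<in>I. F i z)"
  proof (rule sublinear_INF[OF _ bdd])
    show "I \<noteq> {}" using U0 by (auto simp: I_def)
  next
    fix i j y z assume "i \<in> I" "j \<in> I"
    then obtain l u t l' u' t' where i: "i = (l, u, t)" "0 \<le> l" "(u, t) \<in> U"
      and j: "j = (l', u', t')" "0 \<le> l'" "(u', t') \<in> U" by (auto simp: I_def)
    show "\<exists>k\<in>I. F k (y + z) \<le> F i y + F j z"
    proof (cases "l + l' = 0")
      case True
      then have [simp]: "l = 0" "l' = 0" using i j by auto
      show ?thesis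
      proof (rule bexI[of _ i])
        show "F i (y + z) \<le> F i y + F j z"
          using mult_left_mono[OF norm_triangle_ineq[of y z] K0] by (simp add: i(1) j(1) F_def algebra_simps)
      qed fact
    next
      case False
      let ?L = "l + l'"
      define v where "v = (l / ?L) *\<^sub>R u + (l' / ?L) *\<^sub>R u'"
      define s where "s = (l / ?L) * t + (l' / ?L) * t'"
      have L: "?L > 0" using i(2) j(2) False by simp
      have "(l / ?L) *\<^sub>R (u, t) + (l' / ?L) *\<^sub>R (u', t') \<in> U"
        using i j L by (intro convexD[OF U]) (auto simp: add_divide_distrib[symmetric])
      then have "(v, s) \<in> U" by (simp add: v_def s_def)
      then have "(?L, v, s) \<in> I" using L by (simp add: I_def)
      moreover have "?L *\<^sub>R v = l *\<^sub>R u + l' *\<^sub>R u'"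
        using L by (simp add: v_def scaleR_add_right)
      then have "norm (y + z - ?L *\<^sub>R v) \<le> norm (y - l *\<^sub>R u) + norm (z - l' *\<^sub>R u')"
        using norm_triangle_ineq[of "y - l *\<^sub>R u" "z - l' *\<^sub>R u'"] by (simp add: algebra_simps)
      moreover have "?L * s = l * t + l' * t'"
        using L by (simp add: s_def distrib_left)
      ultimately show ?thesis
        using mult_left_mono[OF _ K0]
        by (intro bexI[of _ "(?L, v, s)"]) (auto simp: i(1) j(1) F_def distrib_left[symmetric])
    qed
  next
    fix i c z assume "i \<in> I" "(0::real) < c"
    then obtain l u t where i: "i = (l, u, t)" "0 \<le> l" "(u, t) \<in> U" by (auto simp: I_def)
    have "norm (c *\<^sub>R z - (c * l) *\<^sub>R u) = c * norm (z - l *\<^sub>R u)"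
      using \<open>0 < c\<close> norm_scaleR[of c "z - l *\<^sub>R u"] by (simp add: scaleR_diff_right)
    then have "F (c * l, u, t) (c *\<^sub>R z) = c * F i z"
      by (simp add: i F_def algebra_simps)
    then show "\<exists>k\<in>I. F k (c *\<^sub>R z) \<le> c * F i z"
      using i \<open>0 < c\<close> by (intro bexI[of _ "(c * l, u, t)"]) (auto simp: I_def)
  qed
  then obtain f where f: "linear f" "\<And>z. f z \<le> (INF i\<in>I. F i z)"
    using hahn_banach_sublinear by metis
  \<comment> \<open>Indices with \<open>l = 0\<close> bound \<open>f\<close> by a multiple of the
    norm, hence give continuity; those with \<open>l = 1\<close>, evaluated at \<open>u\<close>,
    give the minorant property.\<close>
  have le: "f z \<le> F i z" if "i \<in> I" for i z
    using f(2) cINF_lower[OF bdd that] order_trans by blast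
  have "f z \<le> K * norm z" for z
    using le[of "(0, u0, t0)" z] U0 by (simp add: I_def F_def)
  from this this[of "- z" for z] have "norm (f z) \<le> norm z * K" for z
    using linear_neg[OF f(1)] by (simp add: abs_le_iff mult.commute)
  then have "bounded_linear f"
    using linear_add[OF f(1)] linear_scale[OF f(1)] by (intro bounded_linear_intro) auto
  moreover have "f u \<le> t" if "(u, t) \<in> U" for u t
    using le[of "(1, u, t)" u] that by (simp add: I_def F_def)
  ultimately show thesis
    by (intro that[of "Blinfun f"]) (simp add: bounded_linear_Blinfun_apply)
qed (use that in auto)

lemma separate_point_subspace:
  fixes V :: "'a::real_normed_vector set"
  assumes V: "closed V" "subspace V" and z: "z \<notin> V"
  obtains f :: "'a \<Rightarrow>\<^sub>L real" where "\<And>v. v \<in> V \<Longrightarrow> blinfun_apply f v = 0" "blinfun_apply f z \<noteq> 0"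
proof -
  obtain d where d: "d > 0" "\<And>v. v \<in> V \<Longrightarrow> d \<le> norm (v - z)"
    using V(1) z by (metis closed_approachable dist_norm not_le)
  \<comment> \<open>This is the graph of the linear functional on the span of \<open>V\<close> and
    \<open>z\<close> that vanishes on \<open>V\<close> and equals \<open>d\<close> at
    \<open>z\<close>. The norm dominates it because \<open>V\<close> keeps distance at least
    \<open>d\<close> from \<open>z\<close>.\<close>
  define U where "U = {(v - c *\<^sub>R z, - c * d) | v c. v \<in> V}"
  have "convex U"
  proof (rule convexI)
    fix p q a b assume "p \<in> U" "q \<in> U" and ab: "(0::real) \<le> a" "(0::real) \<le> b" "a + b = 1"
    then obtain v c v' c' where "v \<in> V" "v' \<in> V" "p = (v - c *\<^sub>R z, - c * d)" "q = (v' - c' *\<^sub>R z, - c' * d)"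
      by (auto simp: U_def)
    moreover from this have "a *\<^sub>R v + b *\<^sub>R v' \<in> V"
      using V(2) by (simp add: subspace_add subspace_scale)
    ultimately show "a *\<^sub>R p + b *\<^sub>R q \<in> U"
      unfolding U_def
      by (auto intro!: exI[of _ "a *\<^sub>R v + b *\<^sub>R v'"] exI[of _ "a * c + b * c'"] simp: algebra_simps)
  qed
  moreover have "- 1 * norm u \<le> t" if ut: "(u, t) \<in> U" for u t
  proof -
    obtain v c where v: "v \<in> V" "u = v - c *\<^sub>R z" "t = - c * d"
      using ut unfolding U_def by blast
    show ?thesis
    proof (cases "c > 0")
      case True
      have "d \<le> norm (inverse c *\<^sub>R v - z)" using V(2) v(1) d(2) by (simp add: subspace_scale)
      then have "c * d \<le> norm (c *\<^sub>R (inverse c *\<^sub>R v - z))"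
        using True by simp
      also have "c *\<^sub>R (inverse c *\<^sub>R v - z) = u" using True v by (simp add: scaleR_diff_right)
      finally show ?thesis by (simp add: v(3))
    next
      case False
      then have "0 \<le> t" using v(3) d(1) by (simp add: mult_nonpos_nonneg)
      then show ?thesis by (smt (verit) norm_ge_zero)
    qed
  qed
  ultimately obtain f :: "'a \<Rightarrow>\<^sub>L real" where f: "\<And>u t. (u, t) \<in> U \<Longrightarrow> blinfun_apply f u \<le> t"
    using affine_minorant[of U 1] by auto
  have le: "f (v - c *\<^sub>R z) \<le> - c * d" if "v \<in> V" for v c
    using that by (intro f) (auto simp: U_def)
  show thesis
  proof (rule that)
    fix v assume v: "v \<in> V"
    then have "- v \<in> V" using V(2) by (simp add: subspace_neg)
    then show "f v = 0" using le[OF v, of 0] le[of "- v" 0] by (simp add: blinfun.bilinear_simps)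
  next
    show "f z \<noteq> 0" using le[of 0 1] V(2) d(1) by (simp add: subspace_0 blinfun.bilinear_simps)
  qed
qed

subsection \<open>Projections of closed convex sets\<close>

text \<open>Iterating \<open>u \<mapsto> 2 (u - y)\<close> with \<open>y \<in> fst ` D\<close> close to \<open>u\<close> writes \<open>w\<close> as a dyadic convex series.\<close>

lemma convex_closed_projection_halving:
  fixes D :: "('a::real_normed_vector \<times> 'b::banach) set"
  assumes D: "convex D" "closed D" and N: "\<And>v y. (v, y) \<in> D \<Longrightarrow> norm y \<le> N"
    and V: "subspace V" and DV: "fst ` D \<subseteq> V"
    and dense: "\<And>v. v \<in> V \<Longrightarrow> norm v < r \<Longrightarrow> v \<in> closure (fst ` D)"
    and r: "0 < r" and w: "w \<in> V" "norm w < r / 2"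
  shows "w \<in> fst ` D"
proof -
  define B where "B = {u \<in> V. norm u < r}"
  have "\<exists>z\<in>D. 2 *\<^sub>R (u - fst z) \<in> B" if u: "u \<in> B" for u
  proof -
    have "u \<in> closure (fst ` D)" using u dense by (simp add: B_def)
    then obtain z where z: "z \<in> D" "dist (fst z) u < r / 2"
      using r by (metis closure_approachable half_gt_zero image_iff)
    moreover have "2 *\<^sub>R (u - fst z) \<in> V"
      using V DV u z(1) by (auto simp: B_def intro!: subspace_scale subspace_diff)
    moreover have "norm (2 *\<^sub>R (u - fst z)) < r"
      using z(2) by (simp add: dist_norm norm_minus_commute)
    ultimately show ?thesis by (auto simp: B_def)
  qed
  then obtain sel where sel: "\<And>u. u \<in> B \<Longrightarrow> sel u \<in> D" "\<And>u. u \<in> B \<Longrightarrow> 2 *\<^sub>R (u - fst (sel u)) \<in> B"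
    by metis
  \<comment> \<open>The starting point has norm below \<open>r\<close> exactly because
    \<open>w\<close> has norm below \<open>r / 2\<close>.\<close>
  define u where "u = rec_nat (2 *\<^sub>R w) (\<lambda>_ u. 2 *\<^sub>R (u - fst (sel u)))"
  have u_Suc: "u (Suc n) = 2 *\<^sub>R (u n - fst (sel (u n)))" for n by (simp add: u_def)
  have u_B: "u n \<in> B" for n
  proof (induction n)
    case 0
    then show ?case using w V by (simp add: u_def B_def subspace_scale)
  qed (simp only: u_Suc sel)
  define z where "z n = sel (u n)" for n
  have zD: "z n \<in> D" for n by (simp add: z_def sel u_B)
  define P where "P n = (\<Sum>k<n. (1/2) ^ Suc k *\<^sub>R z k)" for n
  \<comment> \<open>The leftover weight \<open>(1/2) ^ n\<close> is put on \<open>z n\<close>, which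
    makes this a genuine convex combination; the added term vanishes in the limit.\<close>
  have in_D: "P n + (1/2) ^ n *\<^sub>R z n \<in> D" for n
  proof -
    have wsum: "(\<Sum>k<n. (1/2) ^ Suc k) + (1/2) ^ n = (1::real)" for n
      by (induction n) auto
    have "(\<Sum>k\<in>{..n}. (if k < n then (1/2) ^ Suc k else (1/2) ^ n) *\<^sub>R z k) \<in> D"
    proof (rule convex_sum[OF _ D(1)])
      show "(\<Sum>k\<le>n. if k < n then (1/2) ^ Suc k else (1/2) ^ n) = (1::real)"
        using wsum[of n] by (simp add: lessThan_Suc_atMost[symmetric])
    qed (auto simp: zD)
    then show ?thesis
      by (simp add: lessThan_Suc_atMost[symmetric] P_def)
  qed
  have fstP: "fst (P n) = w - (1/2) ^ Suc n *\<^sub>R u n" for n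
  proof (induction n)
    case 0
    then show ?case by (simp add: P_def u_def)
  next
    case (Suc n)
    have "P (Suc n) = P n + (1/2) ^ Suc n *\<^sub>R z n" by (simp add: P_def)
    then have "fst (P (Suc n)) = w - (1/2) ^ Suc n *\<^sub>R (u n - fst (z n))"
      using Suc by (simp add: algebra_simps)
    also have "u n - fst (z n) = (1/2) *\<^sub>R u (Suc n)"
      by (simp add: u_Suc z_def)
    finally show ?case by simp
  qed
  have half0: "(\<lambda>n. (1/2::real) ^ n) \<longlonglongrightarrow> 0"
    by (simp add: LIMSEQ_realpow_zero)
  have "(\<lambda>n. (1/2::real) ^ Suc n *\<^sub>R u n) \<longlonglongrightarrow> 0"
  proof (rule Lim_null_comparison)
    show "\<forall>\<^sub>F n in sequentially. norm ((1/2::real) ^ Suc n *\<^sub>R u n) \<le> (1/2) ^ Suc n * r"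
      using u_B by (auto simp: B_def intro!: always_eventually mult_left_mono less_imp_le)
    show "(\<lambda>n. (1/2) ^ Suc n * r) \<longlonglongrightarrow> 0"
      using tendsto_mult_left_zero[OF LIMSEQ_Suc[OF half0]] .
  qed
  then have lim1: "(\<lambda>n. fst (P n)) \<longlonglongrightarrow> w"
    unfolding fstP using tendsto_diff[OF tendsto_const] by fastforce
  \<comment> \<open>Second coordinates converge by the bound \<open>N\<close> and completeness of
    the second factor; first coordinates telescope to the prescribed limit \<open>w\<close>.\<close>
  have "summable (\<lambda>k. (1/2::real) ^ Suc k *\<^sub>R snd (z k))"
  proof (rule summable_comparison_test')
    show "summable (\<lambda>k. (1/2) ^ Suc k * N)"
      by (intro summable_mult2) (simp add: summable_geometric)
    show "norm ((1/2::real) ^ Suc k *\<^sub>R snd (z k)) \<le> (1/2) ^ Suc k * N" if "0 \<le> k" for k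
      using N[of "fst (z k)" "snd (z k)"] zD[of k] by simp
  qed
  then have "(\<lambda>n. snd (P n)) \<longlonglongrightarrow> (\<Sum>k. (1/2::real) ^ Suc k *\<^sub>R snd (z k))"
    by (simp add: P_def snd_sum summable_LIMSEQ del: power_Suc)
  moreover have "(\<lambda>n. (1/2::real) ^ n *\<^sub>R snd (z n)) \<longlonglongrightarrow> 0"
  proof (rule Lim_null_comparison)
    show "\<forall>\<^sub>F n in sequentially. norm ((1/2::real) ^ n *\<^sub>R snd (z n)) \<le> (1/2) ^ n * N"
      using N[of "fst (z k)" "snd (z k)" for k] zD by (auto intro!: always_eventually)
    show "(\<lambda>n. (1/2) ^ n * N) \<longlonglongrightarrow> 0"
      using tendsto_mult_left_zero[OF half0] .
  qed
  ultimately have lim2: "(\<lambda>n. snd (P n + (1/2::real) ^ n *\<^sub>R z n)) \<longlonglongrightarrow> (\<Sum>k. (1/2::real) ^ Suc k *\<^sub>R snd (z k))"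
    using tendsto_add by fastforce
  have "norm (fst (z n)) \<le> 2 * r" for n
  proof -
    have "fst (z n) = u n - (1/2) *\<^sub>R u (Suc n)" by (simp add: u_Suc z_def)
    moreover have "norm (u n) < r" "norm (u (Suc n)) < r" using u_B by (auto simp: B_def)
    ultimately show ?thesis
      using norm_triangle_ineq4[of "u n" "(1/2) *\<^sub>R u (Suc n)"] r by simp
  qed
  then have "(\<lambda>n. (1/2::real) ^ n *\<^sub>R fst (z n)) \<longlonglongrightarrow> 0"
    by (intro Lim_null_comparison[OF _ tendsto_mult_left_zero[OF half0, of "2 * r"]])
      (auto intro!: always_eventually)
  then have "(\<lambda>n. fst (P n + (1/2::real) ^ n *\<^sub>R z n)) \<longlonglongrightarrow> w"
    using tendsto_add[OF lim1] by fastforce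
  from tendsto_Pair[OF this lim2]
  have lim: "(\<lambda>n. P n + (1/2::real) ^ n *\<^sub>R z n) \<longlonglongrightarrow> (w, \<Sum>k. (1/2::real) ^ Suc k *\<^sub>R snd (z k))"
    by (simp only: prod.collapse)
  have "(w, \<Sum>k. (1/2::real) ^ Suc k *\<^sub>R snd (z k)) \<in> D"
    by (rule closed_sequentially[OF D(2) _ lim]) (rule in_D)
  then show ?thesis by force
qed

text \<open>By Baire's theorem in \<open>V\<close>, some truncation of \<open>E\<close> has a
  projection whose scaled closure has interior relative to \<open>V\<close>. Convexity moves this
  interior to the origin, and the halving lemma removes the closure at the cost of half the
  radius.\<close>

theorem robinson_ursescu_bounded_fibre:
  fixes E :: "('a::banach \<times> 'b::banach) set"
  assumes E: "convex E" "closed E"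
    and V: "closed V" "subspace V" and EV: "fst ` E \<subseteq> V"
    and absorb: "\<And>v. v \<in> V \<Longrightarrow> \<exists>c>0. c *\<^sub>R v \<in> fst ` E"
  obtains r N where "r > 0" "\<And>v. v \<in> V \<Longrightarrow> norm v < r \<Longrightarrow> \<exists>y. norm y \<le> N \<and> (v, y) \<in> E"
proof -
  define D where "D n = E \<inter> {z. norm (snd z) \<le> real n}" for n
  have D_mono: "D m \<subseteq> D n" if "m \<le> n" for m n
    using that by (auto simp: D_def)
  have D_convex: "convex (D n)" for n
  proof -
    have "{z :: 'a \<times> 'b. norm (snd z) \<le> real n} = UNIV \<times> cball 0 (real n)" by auto
    then show ?thesis unfolding D_def using E(1) by (simp add: convex_Int convex_Times)
  qed
  have D_closed: "closed (D n)" for n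
    unfolding D_def by (intro closed_Int E(2) closed_Collect_le continuous_intros)
  define C where "C n = closure (fst ` D n)" for n
  have C_convex: "convex (C n)" for n
    unfolding C_def by (intro convex_closure convex_linear_image linear_fst D_convex)
  have C_mono: "C m \<subseteq> C n" if "m \<le> n" for m n
    unfolding C_def by (intro closure_mono image_mono D_mono that)
  have C_V: "C n \<subseteq> V" for n
    unfolding C_def using EV V(1) by (intro closure_minimal) (auto simp: D_def)
  have zero: "\<exists>y. (0, y) \<in> E"
    using absorb[of 0] V(2) by (force simp: subspace_0)
  have cover: "\<exists>n. inverse (real (Suc n)) *\<^sub>R v \<in> fst ` D n" if v: "v \<in> V" for v
  proof -
    obtain c y where c: "c > 0" "(c *\<^sub>R v, y) \<in> E" using absorb v by force
    obtain y0 where y0: "(0, y0) \<in> E" using zero by blast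
    obtain n where n: "max (norm y) (max (norm y0) (inverse c)) \<le> real n"
      using real_arch_simple by blast
    \<comment> \<open>Mixing with \<open>(0, y0)\<close> shrinks the first coordinate to the desired
      multiple of \<open>v\<close>; \<open>a \<le> 1\<close> holds because \<open>n\<close> also
      dominates \<open>inverse c\<close>.\<close>
    define a where "a = inverse (c * Suc n)"
    have a: "0 \<le> a" "a \<le> 1"
      using c n by (auto simp: a_def field_simps)
    have "a *\<^sub>R (c *\<^sub>R v, y) + (1 - a) *\<^sub>R (0, y0) \<in> E"
      using a by (intro convexD[OF E(1)] c y0) auto
    moreover have "a * c = inverse (real (Suc n))" using c by (simp add: a_def)
    ultimately have "(inverse (real (Suc n)) *\<^sub>R v, a *\<^sub>R y + (1 - a) *\<^sub>R y0) \<in> E" by simp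
    moreover have "a *\<^sub>R y + (1 - a) *\<^sub>R y0 \<in> cball 0 (real n)"
      using a n by (intro convexD[OF convex_cball]) auto
    ultimately show ?thesis by (auto simp: D_def image_iff intro!: exI[of _ n] bexI)
  qed
  obtain n where n: "top_of_set V interior_of ((*\<^sub>R) (Suc n) ` C n) \<noteq> {}"
  proof (rule ccontr)
    assume "\<not> thesis"
    then have empty: "top_of_set V interior_of ((*\<^sub>R) (Suc n) ` C n) = {}" for n
      using that by blast
    have "completely_metrizable_space (top_of_set V)"
      using V(1) completely_metrizable_space_closedin completely_metrizable_space_euclidean by force
    moreover have "closedin (top_of_set V) ((*\<^sub>R) (Suc n) ` C n)" for n
      using C_V[of n] V by (intro closed_subset closed_scaling) (auto simp: C_def subspace_scale)
    ultimately have "top_of_set V interior_of \<Union> (range (\<lambda>n. (*\<^sub>R) (Suc n) ` C n)) = {}"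
      using empty by (intro Baire_category_alt) auto
    moreover have "\<Union> (range (\<lambda>n. (*\<^sub>R) (Suc n) ` C n)) = V"
    proof
      show "\<Union> (range (\<lambda>n. (*\<^sub>R) (Suc n) ` C n)) \<subseteq> V"
        using C_V V(2) by (blast intro: subspace_scale)
      show "V \<subseteq> \<Union> (range (\<lambda>n. (*\<^sub>R) (Suc n) ` C n))"
      proof
        fix v assume "v \<in> V"
        then obtain n where "inverse (real (Suc n)) *\<^sub>R v \<in> C n"
          using cover closure_subset unfolding C_def by blast
        then have "(real (Suc n)) *\<^sub>R inverse (real (Suc n)) *\<^sub>R v \<in> (*\<^sub>R) (Suc n) ` C n"
          by (rule imageI)
        then have "v \<in> (*\<^sub>R) (Suc n) ` C n" by simp
        then show "v \<in> \<Union> (range (\<lambda>n. (*\<^sub>R) (Suc n) ` C n))" by blast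
      qed
    qed
    ultimately have "V = {}"
      by (metis interior_of_topspace topspace_euclidean_subtopology)
    then show False using V(2) subspace_0 by blast
  qed
  then obtain c where "c \<in> top_of_set V interior_of ((*\<^sub>R) (Suc n) ` C n)" by blast
  then obtain W where W: "open W" "c \<in> W" "c \<in> V" "V \<inter> W \<subseteq> (*\<^sub>R) (Suc n) ` C n"
    unfolding interior_of_def openin_open by blast
  then obtain e where e: "e > 0" "ball c e \<subseteq> W" by (meson open_contains_ball)
  have ball_C: "inverse (real (Suc n)) *\<^sub>R x \<in> C n" if x: "x \<in> V" "norm (x - c) < e" for x
  proof -
    have "x \<in> ball c e" using x(2) by (simp add: dist_norm norm_minus_commute)
    then obtain y where "y \<in> C n" "x = real (Suc n) *\<^sub>R y" using W(4) e(2) x(1) by blast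
    then show ?thesis by simp
  qed
  have "- c \<in> V" using W(3) V(2) by (simp add: subspace_neg)
  then obtain m where m: "inverse (real (Suc m)) *\<^sub>R (- c) \<in> C m"
    using cover closure_subset unfolding C_def by blast
  define N where "N = max m n"
  define \<nu> \<mu> where "\<nu> = real (Suc n)" and "\<mu> = real (Suc m)"
  have pos: "\<nu> > 0" "\<mu> > 0" by (auto simp: \<nu>_def \<mu>_def)
  \<comment> \<open>With weights \<open>\<nu> / (\<mu> + \<nu>)\<close> and
    \<open>\<mu> / (\<mu> + \<nu>)\<close> the contributions of \<open>c\<close> and
    \<open>- c\<close> cancel and leave \<open>v\<close>; this radius keeps
    \<open>c + (\<mu> + \<nu>) *\<^sub>R v\<close> within \<open>e\<close> of
    \<open>c\<close>.\<close>
  define r where "r = e / (\<mu> + \<nu>)"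
  have r: "r > 0" using e pos by (simp add: r_def)
  have dense: "v \<in> C N" if v: "v \<in> V" "norm v < r" for v
  proof -
    have "norm ((\<mu> + \<nu>) *\<^sub>R v) < e"
      using v(2) pos by (simp add: r_def pos_less_divide_eq mult.commute)
    then have "inverse \<nu> *\<^sub>R (c + (\<mu> + \<nu>) *\<^sub>R v) \<in> C n"
      unfolding \<nu>_def by (intro ball_C) (use v(1) W(3) V(2) in \<open>auto simp: subspace_add subspace_scale\<close>)
    moreover have "inverse \<mu> *\<^sub>R (- c) \<in> C m" using m by (simp add: \<mu>_def)
    ultimately have "(\<nu> / (\<mu> + \<nu>)) *\<^sub>R inverse \<nu> *\<^sub>R (c + (\<mu> + \<nu>) *\<^sub>R v)
        + (\<mu> / (\<mu> + \<nu>)) *\<^sub>R inverse \<mu> *\<^sub>R (- c) \<in> C N"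
      using pos C_mono[of n N] C_mono[of m N]
      by (intro convexD[OF C_convex]) (auto simp: N_def add_divide_distrib[symmetric] add.commute)
    moreover have "(\<nu> / (\<mu> + \<nu>)) *\<^sub>R inverse \<nu> *\<^sub>R (c + (\<mu> + \<nu>) *\<^sub>R v)
        + (\<mu> / (\<mu> + \<nu>)) *\<^sub>R inverse \<mu> *\<^sub>R (- c) = v"
    proof -
      have S: "\<nu> / (\<mu> + \<nu>) * inverse \<nu> = inverse (\<mu> + \<nu>)" "\<mu> / (\<mu> + \<nu>) * inverse \<mu> = inverse (\<mu> + \<nu>)"
        "\<mu> + \<nu> \<noteq> 0"
        using pos by (auto simp: field_simps)
      show ?thesis unfolding scaleR_scaleR S(1,2) using S(3) by (simp add: scaleR_add_right)
    qed
    ultimately show ?thesis by simp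
  qed
  have "\<exists>y. norm y \<le> real N \<and> (v, y) \<in> E" if v: "v \<in> V" "norm v < r / 2" for v
  proof -
    have "v \<in> fst ` D N"
    proof (rule convex_closed_projection_halving[OF D_convex D_closed _ V(2) _ _ r v])
      show "norm y \<le> real N" if "(u, y) \<in> D N" for u y using that by (simp add: D_def)
      show "fst ` D N \<subseteq> V" using EV by (auto simp: D_def)
      show "u \<in> closure (fst ` D N)" if "u \<in> V" "norm u < r" for u
        using dense[OF that] by (simp add: C_def)
    qed
    then show ?thesis by (auto simp: D_def)
  qed
  then show thesis using that r by (metis half_gt_zero)
qed

section \<open>Subgradients at a core point\<close>

text \<open>Joining a point over \<open>u\<close> to the point of height \<open>M\<close> over a
  negative multiple of \<open>u\<close> produces a point over the origin, where heights are
  nonnegative. This gives the growth condition of \<open>affine_minorant\<close>.\<close>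

lemma convex_subgradient_at_core:
  fixes U :: "('a::real_normed_vector \<times> real) set"
  assumes U: "convex U" and W: "subspace W" "fst ` U \<subseteq> W"
    and ball: "\<And>u. u \<in> W \<Longrightarrow> norm u < r \<Longrightarrow> (u, M) \<in> U" and r: "0 < r"
    and zero: "\<And>t. (0, t) \<in> U \<Longrightarrow> 0 \<le> t"
  obtains f :: "'a \<Rightarrow>\<^sub>L real" where "\<And>u t. (u, t) \<in> U \<Longrightarrow> blinfun_apply f u \<le> t"
proof (rule affine_minorant[OF U, of "2 * M / r"])
  have M: "0 \<le> M" using ball[of 0] W(1) r zero by (simp add: subspace_0)
  then show "0 \<le> 2 * M / r" using r by simp
  fix u t assume ut: "(u, t) \<in> U"
  show "- (2 * M / r) * norm u \<le> t"
  proof (cases "u = 0")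
    case False
    define \<rho> where "\<rho> = r / 2"
    define S where "S = \<rho> + norm u"
    have pos: "\<rho> > 0" "S > 0" using r by (auto simp: \<rho>_def S_def add_pos_nonneg)
    have "u \<in> W" using W(2) ut by force
    then have "((- \<rho> / norm u) *\<^sub>R u, M) \<in> U"
      using W(1) False r by (intro ball) (auto simp: subspace_scale subspace_neg \<rho>_def)
    then have "(\<rho> / S) *\<^sub>R (u, t) + (norm u / S) *\<^sub>R ((- \<rho> / norm u) *\<^sub>R u, M) \<in> U"
      using pos ut by (intro convexD[OF U]) (auto simp: add_divide_distrib[symmetric] S_def)
    moreover have "(\<rho> / S) *\<^sub>R (u, t) + (norm u / S) *\<^sub>R ((- \<rho> / norm u) *\<^sub>R u, M)
        = (0, (\<rho> * t + norm u * M) / S)"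
      using False by (simp add: add_divide_distrib)
    ultimately have "0 \<le> (\<rho> * t + norm u * M) / S" by (intro zero) (simp only:)
    then have "0 \<le> \<rho> * t + norm u * M" using pos by (simp add: zero_le_divide_iff)
    then show ?thesis using r by (simp add: \<rho>_def field_simps)
  qed (use zero ut in simp)
qed (use that in blast)

lemma inner_self_convex:
  fixes x y :: "'a::real_inner"
  assumes "0 \<le> a" "0 \<le> b" "a + b = 1"
  shows "inner (a *\<^sub>R x + b *\<^sub>R y) (a *\<^sub>R x + b *\<^sub>R y) \<le> a * inner x x + b * inner y y"
proof -
  have "a * inner x x + b * inner y y - inner (a *\<^sub>R x + b *\<^sub>R y) (a *\<^sub>R x + b *\<^sub>R y)
      = a * b * inner (x - y) (x - y)"
  proof -
    have b: "b = 1 - a" using assms(3) by simp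
    show ?thesis unfolding b
      by (simp add: inner_simps inner_commute[of y x] algebra_simps)
  qed
  moreover have "0 \<le> a * b * inner (x - y) (x - y)" using assms by simp
  ultimately show ?thesis by linarith
qed

subsection \<open>The conjugate and its contact set\<close>

text \<open>Replaces the extended-real supremum by real inequalities over the epigraph of
  \<open>h\<close>; points where \<open>h\<close> is infinite constrain neither side.\<close>

lemma Jconj_le_iff:
  assumes "\<forall>p. h p \<ge> ereal (pairing p)"
  shows "Jconj h p \<le> ereal c \<longleftrightarrow>
    (\<forall>y y' t. h (y, y') \<le> ereal t \<longrightarrow> blinfun_apply (snd p) y + blinfun_apply y' (fst p) - t \<le> c)"
proof -
  have "ereal s - h q \<le> ereal c \<longleftrightarrow> (\<forall>t. h q \<le> ereal t \<longrightarrow> s - t \<le> c)" for s q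
  proof (cases "h q")
    case (real k)
    show ?thesis
    proof
      assume "ereal s - h q \<le> ereal c"
      then show "\<forall>t. h q \<le> ereal t \<longrightarrow> s - t \<le> c" using real by auto
    qed (use real in auto)
  next
    case MInf
    then show ?thesis using assms[rule_format, of q] by simp
  qed auto
  then show ?thesis by (simp add: Jconj_def SUP_le_iff)
qed

text \<open>Each point of the epigraph of \<open>h\<close> contributes an inequality that is affine
  in point and height jointly.\<close>

lemma Jconj_convex:
  assumes "\<forall>p. h p \<ge> ereal (pairing p)"
  shows "convex_fun (Jconj h)"
  unfolding convex_fun_def
proof (rule convexI)
  fix P Q a b assume PQ: "P \<in> {(p, t). Jconj h p \<le> ereal t}" "Q \<in> {(p, t). Jconj h p \<le> ereal t}"
    and ab: "(0::real) \<le> a" "(0::real) \<le> b" "a + b = 1"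
  obtain x x' s where P: "P = ((x, x'), s)" by (metis prod.exhaust)
  obtain z z' u where Q: "Q = ((z, z'), u)" by (metis prod.exhaust)
  have "blinfun_apply (a *\<^sub>R x' + b *\<^sub>R z') y + blinfun_apply y' (a *\<^sub>R x + b *\<^sub>R z) - t \<le> a * s + b * u"
    if "h (y, y') \<le> ereal t" for y y' t
  proof -
    have "x' y + y' x - t \<le> s" "z' y + y' z - t \<le> u"
      using PQ that by (auto simp: P Q Jconj_le_iff[OF assms])
    then have "a * (x' y + y' x - t) + b * (z' y + y' z - t) \<le> a * s + b * u"
      using ab by (intro add_mono mult_left_mono)
    moreover have "a * t + b * t = t" using ab(3) by (metis distrib_right mult_1)
    ultimately show ?thesis
      by (simp add: blinfun.bilinear_simps algebra_simps)
  qed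
  then show "a *\<^sub>R P + b *\<^sub>R Q \<in> {(p, t). Jconj h p \<le> ereal t}"
    by (simp add: P Q Jconj_le_iff[OF assms])
qed

text \<open>Real sublevel sets are intersections of closed sets given by continuous affine
  functions; the level minus infinity is empty by the lower bound on \<open>Jconj h\<close>.\<close>

lemma Jconj_lsc:
  assumes h: "\<forall>p. h p \<ge> ereal (pairing p)" and J: "\<forall>p. Jconj h p \<ge> ereal (pairing p)"
  shows "lsc_fun (Jconj h)"
  unfolding lsc_fun_def
proof
  fix c :: ereal
  show "closed {p. Jconj h p \<le> c}"
  proof (cases c)
    case (real r)
    have "{p. Jconj h p \<le> c} = (\<Inter>(y, y', t)\<in>{(y, y', t). h (y, y') \<le> ereal t}.
        {p. blinfun_apply (snd p) y + blinfun_apply y' (fst p) - t \<le> r})"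
      by (auto simp: real Jconj_le_iff[OF h])
    also have "closed \<dots>"
      by (intro closed_INT ballI) (auto intro!: closed_Collect_le continuous_intros)
    finally show ?thesis .
  next
    case MInf
    have "\<not> Jconj h p \<le> - \<infinity>" for p
      using J[rule_format, of p] by (metis MInfty_neq_ereal(1) ereal_infty_less_eq(2) order_trans)
    then show ?thesis by (simp add: MInf)
  qed simp
qed

text \<open>The midpoint of two contact points has value at most the mean of the two pairings.\<close>

lemma monotone_contact_set:
  assumes g: "convex_fun g" "\<forall>p. g p \<ge> ereal (pairing p)"
  shows "monotone_op {p. g p = ereal (pairing p)}"
proof -
  have "0 \<le> blinfun_apply (x' - y') (x - y)"
    if x: "g (x, x') = ereal (pairing (x, x'))" and y: "g (y, y') = ereal (pairing (y, y'))"
    for x x' y y'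
  proof -
    have "(1/2) *\<^sub>R ((x, x'), x' x) + (1/2) *\<^sub>R ((y, y'), y' y) \<in> {(p, t). g p \<le> ereal t}"
      using x y by (intro convexD[OF g(1)[unfolded convex_fun_def]]) (auto simp: pairing_def)
    then have "g ((1/2) *\<^sub>R (x + y), (1/2) *\<^sub>R (x' + y')) \<le> ereal ((x' x + y' y) / 2)"
      by (simp add: scaleR_add_right add_divide_distrib)
    then have "ereal (pairing ((1/2) *\<^sub>R (x + y), (1/2) *\<^sub>R (x' + y'))) \<le> ereal ((x' x + y' y) / 2)"
      using g(2) order_trans by blast
    then show ?thesis
      by (simp add: pairing_def blinfun.bilinear_simps field_simps)
  qed
  then show ?thesis unfolding monotone_op_def by blast
qed

text \<open>Fenchel duality between the translate of \<open>h\<close> to \<open>(x0, x0')\<close> and the square function carried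
  by the span of \<open>x0\<close> and \<open>a\<close>. As this second function is finite only on a finite-dimensional space
  in the first variable, the bidual component of the dual solution lies in \<open>X\<close> itself. The vector
  \<open>x0\<close> is needed in the span so that the span passes through a core point of the domain.\<close>

lemma contact_point_near:
  fixes h :: "('a::banach) pt \<Rightarrow> ereal" and x0' :: "'a \<Rightarrow>\<^sub>L real"
  assumes conv: "convex_fun h"
    and h: "\<forall>p. h p \<ge> ereal (pairing p)" and J: "\<forall>p. Jconj h p \<ge> ereal (pairing p)"
    and V: "closed V" "subspace V" and DV: "PrX (effdom h) \<subseteq> V"
    and absorb: "\<And>v. v \<in> V \<Longrightarrow> \<exists>c>0. c *\<^sub>R v \<in> PrX (effdom h)"
    and x0: "x0 \<in> V" and a: "a \<in> V"
  obtains x' :: "'a \<Rightarrow>\<^sub>L real" where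
    "Jconj h (x0 - (x' x0 *\<^sub>R x0 + x' a *\<^sub>R a), x0' + x')
      = ereal (pairing (x0 - (x' x0 *\<^sub>R x0 + x' a *\<^sub>R a), x0' + x'))"
proof -
  \<comment> \<open>The epigraph is regrouped so that its second factor is the Banach space of pairs
    \<open>(y', t)\<close>. Its closure supplies the closedness that the Robinson--Ursescu argument
    needs; \<open>E_ge\<close> shows that the pairing bound survives, by joint continuity.\<close>
  define E0 where "E0 = {(y, y', t). h (y, y') \<le> ereal t}"
  define E where "E = closure E0"
  have "convex E0"
  proof (rule convexI)
    fix P Q :: "'a \<times> ('a \<Rightarrow>\<^sub>L real) \<times> real" and c d :: real
    assume PQ: "P \<in> E0" "Q \<in> E0" and cd: "0 \<le> c" "0 \<le> d" "c + d = 1"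
    obtain x x' s y y' t where P: "P = (x, x', s)" and Q: "Q = (y, y', t)" by (metis prod.exhaust)
    have "c *\<^sub>R ((x, x'), s) + d *\<^sub>R ((y, y'), t) \<in> {(p, t). h p \<le> ereal t}"
      using PQ cd by (intro convexD[OF conv[unfolded convex_fun_def]]) (auto simp: P Q E0_def)
    then show "c *\<^sub>R P + d *\<^sub>R Q \<in> E0" by (simp add: P Q E0_def)
  qed
  then have E_convex: "convex E" unfolding E_def by (rule convex_closure)
  have E_closed: "closed E" unfolding E_def by simp
  have E_ge: "y' y \<le> t" if "(y, y', t) \<in> E" for y y' t
  proof -
    have "E \<subseteq> {z. blinfun_apply (fst (snd z)) (fst z) \<le> snd (snd z)}"
      unfolding E_def
    proof (rule closure_minimal)
      show "E0 \<subseteq> {z. blinfun_apply (fst (snd z)) (fst z) \<le> snd (snd z)}"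
      proof
        fix z assume "z \<in> E0"
        then have "ereal (pairing (fst z, fst (snd z))) \<le> ereal (snd (snd z))"
          using h order_trans by (fastforce simp: E0_def)
        then show "z \<in> {z. blinfun_apply (fst (snd z)) (fst z) \<le> snd (snd z)}"
          by (simp add: pairing_def)
      qed
      show "closed {z :: 'a \<times> ('a \<Rightarrow>\<^sub>L real) \<times> real. blinfun_apply (fst (snd z)) (fst z) \<le> snd (snd z)}"
        by (intro closed_Collect_le continuous_intros)
    qed
    then show ?thesis using that by force
  qed
  have E0_dom: "y \<in> PrX (effdom h)" if "h (y, y') \<le> ereal t" for y y' t
    using that by (auto simp: PrX_def effdom_def intro!: exI[of _ y'] order.strict_trans1)
  have "E \<subseteq> V \<times> UNIV"
    unfolding E_def using DV E0_dom V(1)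
    by (intro closure_minimal closed_Times) (auto simp: E0_def)
  then have E_V: "fst ` E \<subseteq> V" by auto
  have "PrX (effdom h) \<subseteq> fst ` E"
  proof
    fix y assume "y \<in> PrX (effdom h)"
    then obtain y' where y': "h (y, y') < \<infinity>" by (auto simp: PrX_def effdom_def)
    then obtain t where "h (y, y') \<le> ereal t"
      by (cases "h (y, y')") auto
    then have "(y, y', t) \<in> E" using closure_subset[of E0] by (auto simp: E_def E0_def)
    then show "y \<in> fst ` E" by force
  qed
  then have "\<exists>c>0. c *\<^sub>R v \<in> fst ` E" if "v \<in> V" for v
    using absorb[OF that] by blast
  then obtain r N where r: "r > 0"
    and fibre: "\<And>v. v \<in> V \<Longrightarrow> norm v < r \<Longrightarrow> \<exists>z. norm z \<le> N \<and> (v, z) \<in> E"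
    using robinson_ursescu_bounded_fibre[OF E_convex E_closed V E_V] by blast

  \<comment> \<open>\<open>At\<close> is the adjoint of \<open>A\<close>, as recorded in
    \<open>AtA\<close>.\<close>
  define A where "A \<sigma> = fst \<sigma> *\<^sub>R x0 + snd \<sigma> *\<^sub>R a" for \<sigma> :: "real \<times> real"
  define At where "At z' = (z' x0, z' a)" for z' :: "'a \<Rightarrow>\<^sub>L real"
  have AtA: "z' (A \<sigma>) = inner (At z') \<sigma>" for z' :: "'a \<Rightarrow>\<^sub>L real" and \<sigma>
    by (simp add: A_def At_def blinfun.bilinear_simps inner_prod_def mult.commute)
  have A_lin: "A (c *\<^sub>R \<sigma> + d *\<^sub>R \<upsilon>) = c *\<^sub>R A \<sigma> + d *\<^sub>R A \<upsilon>" for c d \<sigma> \<upsilon>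
    by (simp add: A_def algebra_simps)
  have At_lin: "At (c *\<^sub>R z' + d *\<^sub>R w') = c *\<^sub>R At z' + d *\<^sub>R At w'" for c d z' w'
    by (simp add: At_def blinfun.bilinear_simps)
  have A_V: "A \<sigma> \<in> V" for \<sigma>
    using x0 a V(2) by (simp add: A_def subspace_add subspace_scale)
  \<comment> \<open>In terms of \<open>u = y - x0\<close> and \<open>u' = y' - x0'\<close> this is
    \<open>t - u' x0 - x0' u - x0' x0\<close>, the height for the translate of
    \<open>h\<close>.\<close>
  define lin where "lin y y' t = t - y' x0 - x0' y + x0' x0"
    for y :: 'a and y' :: "'a \<Rightarrow>\<^sub>L real" and t
  define val where "val y y' t \<sigma> \<omega> = lin y y' t + inner \<sigma> \<sigma> / 2 + inner \<omega> \<omega> / 2"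
    for y y' t and \<sigma> \<omega> :: "real \<times> real"
  \<comment> \<open>Heights above the value function of the primal problem whose constraints
    \<open>y - x0 = A \<sigma>\<close> and \<open>\<omega> = At (y' - x0')\<close> are perturbed in
    \<open>X\<close> and in the plane. A subgradient at zero is therefore a dual solution made of a
    functional on \<open>X\<close> and a vector of the plane.\<close>
  define U where "U = {((y - x0 - A \<sigma>, \<omega> - At (y' - x0')), k) | y y' t \<sigma> \<omega> k.
    (y, y', t) \<in> E \<and> val y y' t \<sigma> \<omega> \<le> k}"
  have UI: "((v, w), k) \<in> U"
    if "(y, y', t) \<in> E" "val y y' t \<sigma> \<omega> \<le> k" "v = y - x0 - A \<sigma>" "w = \<omega> - At (y' - x0')"
    for v w k y y' t \<sigma> \<omega>
    using that unfolding U_def by blast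
  have UE: "\<exists>y y' t \<sigma> \<omega>. (y, y', t) \<in> E \<and> val y y' t \<sigma> \<omega> \<le> k \<and> v = y - x0 - A \<sigma> \<and> w = \<omega> - At (y' - x0')"
    if "((v, w), k) \<in> U" for v w k
    using that unfolding U_def by blast
  have "convex U"
  proof (rule convexI)
    fix P Q and c d :: real assume PQ: "P \<in> U" "Q \<in> U" and cd: "0 \<le> c" "0 \<le> d" "c + d = 1"
    obtain v w k where P: "P = ((v, w), k)" by (metis prod.exhaust)
    obtain v' w' k' where Q: "Q = ((v', w'), k')" by (metis prod.exhaust)
    obtain y y' t \<sigma> \<omega> where 1: "(y, y', t) \<in> E" "val y y' t \<sigma> \<omega> \<le> k" "v = y - x0 - A \<sigma>" "w = \<omega> - At (y' - x0')"
      using UE PQ(1) unfolding P by blast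
    obtain z z' s \<upsilon> \<psi> where 2: "(z, z', s) \<in> E" "val z z' s \<upsilon> \<psi> \<le> k'" "v' = z - x0 - A \<upsilon>" "w' = \<psi> - At (z' - x0')"
      using UE PQ(2) unfolding Q by blast
    have d: "d = 1 - c" using cd by simp
    have "((c *\<^sub>R v + d *\<^sub>R v', c *\<^sub>R w + d *\<^sub>R w'), c * k + d * k') \<in> U"
    proof (rule UI)
      show "(c *\<^sub>R y + d *\<^sub>R z, c *\<^sub>R y' + d *\<^sub>R z', c * t + d * s) \<in> E"
        using convexD[OF E_convex 1(1) 2(1) cd] by simp
      have "val (c *\<^sub>R y + d *\<^sub>R z) (c *\<^sub>R y' + d *\<^sub>R z') (c * t + d * s) (c *\<^sub>R \<sigma> + d *\<^sub>R \<upsilon>) (c *\<^sub>R \<omega> + d *\<^sub>R \<psi>)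
          \<le> c * val y y' t \<sigma> \<omega> + d * val z z' s \<upsilon> \<psi>"
      proof -
        have "lin (c *\<^sub>R y + d *\<^sub>R z) (c *\<^sub>R y' + d *\<^sub>R z') (c * t + d * s) = c * lin y y' t + d * lin z z' s"
          unfolding lin_def d by (simp add: blinfun.bilinear_simps algebra_simps)
        then show ?thesis
          using inner_self_convex[OF cd, of \<sigma> \<upsilon>] inner_self_convex[OF cd, of \<omega> \<psi>]
          unfolding val_def distrib_left by linarith
      qed
      also have "\<dots> \<le> c * k + d * k'"
        using 1(2) 2(2) cd by (intro add_mono mult_left_mono)
      finally show "val (c *\<^sub>R y + d *\<^sub>R z) (c *\<^sub>R y' + d *\<^sub>R z') (c * t + d * s) (c *\<^sub>R \<sigma> + d *\<^sub>R \<upsilon>) (c *\<^sub>R \<omega> + d *\<^sub>R \<psi>)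
          \<le> c * k + d * k'" .
      show "c *\<^sub>R v + d *\<^sub>R v' = c *\<^sub>R y + d *\<^sub>R z - x0 - A (c *\<^sub>R \<sigma> + d *\<^sub>R \<upsilon>)"
        unfolding 1 2 A_lin unfolding d by (simp add: algebra_simps)
      show "c *\<^sub>R w + d *\<^sub>R w' = c *\<^sub>R \<omega> + d *\<^sub>R \<psi> - At (c *\<^sub>R y' + d *\<^sub>R z' - x0')"
      proof -
        have eq: "c *\<^sub>R y' + d *\<^sub>R z' - x0' = c *\<^sub>R (y' - x0') + d *\<^sub>R (z' - x0')"
          unfolding d by (simp add: algebra_simps)
        show ?thesis unfolding 1 2 eq At_lin by (simp add: scaleR_diff_right)
      qed
    qed
    then show "c *\<^sub>R P + d *\<^sub>R Q \<in> U" by (simp add: P Q)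
  qed
  moreover have "subspace (V \<times> (UNIV :: (real \<times> real) set))"
    using V(2) by (simp add: subspace_Times)
  moreover have "fst ` U \<subseteq> V \<times> UNIV"
    using E_V A_V x0 V(2) unfolding U_def by (force intro: subspace_diff)
  moreover have "0 \<le> k" if k: "(0, k) \<in> U" for k
  proof -
    obtain y y' t \<sigma> \<omega> where 1: "(y, y', t) \<in> E" "val y y' t \<sigma> \<omega> \<le> k" "0 = y - x0 - A \<sigma>" "0 = \<omega> - At (y' - x0')"
      using UE[of 0 0 k] k unfolding zero_prod_def[where 'a='a and 'b="real \<times> real"] by blast
    then have eq: "y - x0 = A \<sigma>" "\<omega> = At (y' - x0')" by auto
    \<comment> \<open>Without perturbation the pairing term equals the inner product of \<sigma> and
      \<omega>, which completes the square.\<close>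
    have "0 \<le> inner (\<sigma> + \<omega>) (\<sigma> + \<omega>) / 2" by simp
    also have "\<dots> = (y' - x0') (y - x0) + inner \<sigma> \<sigma> / 2 + inner \<omega> \<omega> / 2"
      unfolding eq(1) AtA eq(2)[symmetric]
      by (simp add: inner_add_left inner_add_right inner_commute[of \<sigma> \<omega>] del: inner_Pair)
    also have "\<dots> \<le> val y y' t \<sigma> \<omega>"
      using E_ge[OF 1(1)] by (simp add: val_def lin_def blinfun.bilinear_simps)
    finally show ?thesis using 1(2) by simp
  qed
  \<comment> \<open>The choice \<open>\<sigma> = (-1, 0)\<close> gives
    \<open>A \<sigma> = - x0\<close>, so \<open>y\<close> is the small vector \<open>v\<close>
    itself and has a fibre bounded by \<open>N\<close>. The summand \<open>1 / 2\<close> of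
    \<open>M\<close> is half the squared norm of this \<sigma>.\<close>
  moreover have "\<exists>M. \<forall>u\<in>V \<times> UNIV. norm u < r \<longrightarrow> (u, M) \<in> U"
  proof -
    define L where "L = norm x0 + norm a"
    define R where "R = r + (N + norm x0') * L"
    define M where "M = N + N * norm x0 + norm x0' * r + norm x0' * norm x0 + 1 / 2 + R\<^sup>2 / 2"
    have "((v, w), M) \<in> U" if v: "v \<in> V" "norm (v, w) < r" for v w
    proof -
      have nv: "norm v < r" and nw: "norm w < r"
        using v(2) norm_fst_le[of v w] norm_snd_le[of w v] by auto
      obtain y' t where E: "(v, y', t) \<in> E" and N: "norm (y', t) \<le> N"
        using fibre[OF v(1) nv] by force
      have ny': "norm y' \<le> N" and t: "t \<le> N"
        using N norm_fst_le[of y' t] norm_snd_le[of t y'] by auto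
      define \<omega> where "\<omega> = w + At (y' - x0')"
      have nz: "norm (y' - x0') \<le> N + norm x0'"
        using norm_triangle_ineq4[of y' x0'] ny' by simp
      have "norm (At (y' - x0')) \<le> norm ((y' - x0') x0) + norm ((y' - x0') a)"
        unfolding At_def by (rule norm_Pair_le)
      also have "\<dots> \<le> norm (y' - x0') * L"
        using norm_blinfun[of "y' - x0'"] by (simp add: L_def distrib_left add_mono)
      also have "\<dots> \<le> (N + norm x0') * L"
        by (intro mult_right_mono nz) (simp add: L_def)
      finally have "norm \<omega> \<le> R"
        using norm_triangle_ineq[of w "At (y' - x0')"] nw by (simp add: \<omega>_def R_def)
      then have "inner \<omega> \<omega> \<le> R\<^sup>2"
        by (metis norm_ge_zero power2_norm_eq_inner power_mono)
      moreover have "- y' x0 \<le> N * norm x0"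
        using norm_blinfun[of y' x0] mult_right_mono[OF ny' norm_ge_zero[of x0]] by simp
      moreover have "- x0' v \<le> norm x0' * r"
        using norm_blinfun[of x0' v] mult_left_mono[OF less_imp_le[OF nv] norm_ge_zero[of x0']] by simp
      moreover have "x0' x0 \<le> norm x0' * norm x0"
        using norm_blinfun[of x0' x0] by simp
      ultimately have "val v y' t (-1, 0) \<omega> \<le> M"
        using t unfolding val_def lin_def M_def by simp
      then show ?thesis by (rule UI[OF E]) (simp_all add: A_def \<omega>_def)
    qed
    then show ?thesis by auto
  qed
  ultimately obtain f :: "('a \<times> real \<times> real) \<Rightarrow>\<^sub>L real"
    where f: "\<And>u t. (u, t) \<in> U \<Longrightarrow> blinfun_apply f u \<le> t"
    using convex_subgradient_at_core[of U "V \<times> UNIV"] r by metis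
  define x' where "x' = Blinfun (\<lambda>v. f (v, 0))"
  define \<tau> where "\<tau> = (f (0, 1, 0), f (0, 0, 1))"
  have "bounded_linear (\<lambda>v. f (v, 0))"
    by (intro bounded_linear_intros)
  then have x': "x' v = f (v, 0)" for v
    by (simp add: x'_def bounded_linear_Blinfun_apply)
  have f_eq: "f (v, w) = x' v + inner \<tau> w" for v w
  proof -
    have "(v, w) = (v, 0) + fst w *\<^sub>R (0, 1, 0) + snd w *\<^sub>R (0, 0, 1)" by (simp add: prod_eq_iff)
    then have "f (v, w) = f ((v, 0) + fst w *\<^sub>R (0, 1, 0) + snd w *\<^sub>R (0, 0, 1))" by simp
    also have "\<dots> = f (v, 0) + fst w * f (0, 1, 0) + snd w * f (0, 0, 1)"
      by (simp only: blinfun.bilinear_simps real_scaleR_def)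
    finally show ?thesis by (simp add: x' \<tau>_def inner_prod_def mult.commute)
  qed
  define q where "q = (x0 - A \<tau>, x0' + x')"
  define gap where "gap = inner (At x' - \<tau>) (At x' - \<tau>) / 2"
  have "Jconj h q \<le> ereal (pairing q - gap)"
    unfolding Jconj_le_iff[OF h]
  proof (intro allI impI)
    fix y y' t assume "h (y, y') \<le> ereal t"
    then have "(y, y', t) \<in> E" using closure_subset[of E0] by (auto simp: E_def E0_def)
    \<comment> \<open>These \<sigma> and \<omega> optimise the subgradient inequality. The resulting
      bound falls short of the pairing by \<open>gap\<close>, so the lower bound on
      \<open>Jconj h\<close> forces \<tau> to equal \<open>At x'\<close>.\<close>
    then have "((y - x0 - A (- At x'), \<tau> - At (y' - x0')), val y y' t (- At x') \<tau>) \<in> U"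
      by (rule UI) auto
    then have *: "x' (y - x0 - A (- At x')) + inner \<tau> (\<tau> - At (y' - x0')) \<le> val y y' t (- At x') \<tau>"
      using f f_eq by metis
    have A1: "inner \<tau> (At (y' - x0')) = (y' - x0') (A \<tau>)" "inner (At x') \<tau> = x' (A \<tau>)"
      using AtA by (simp_all add: inner_commute)
    have A2: "x' (A (- At x')) = - inner (At x') (At x')"
      by (simp add: AtA del: inner_Pair)
    have gap: "gap = inner (At x') (At x') / 2 - x' (A \<tau>) + inner \<tau> \<tau> / 2"
      unfolding gap_def A1(2)[symmetric]
      by (simp add: inner_diff_left inner_diff_right inner_commute[of \<tau> "At x'"] diff_divide_distrib del: inner_Pair)
    from * show "blinfun_apply (snd q) y + blinfun_apply y' (fst q) - t \<le> pairing q - gap"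
      unfolding gap
      by (simp add: q_def pairing_def val_def lin_def blinfun.bilinear_simps inner_diff_right A1 A2 del: inner_Pair)
  qed
  then have "ereal (pairing q) \<le> ereal (pairing q - gap)"
    using J order_trans by blast
  then have "gap \<le> 0" by simp
  then have tau: "\<tau> = At x'"
    by (simp add: gap_def del: inner_Pair) (metis eq_iff_diff_eq_0 inner_ge_zero inner_gt_zero_iff not_le)
  then have "gap = 0" by (simp add: gap_def)
  with \<open>Jconj h q \<le> ereal (pairing q - gap)\<close> have "Jconj h q = ereal (pairing q)"
    using J[rule_format, of q] by simp
  moreover have "q = (x0 - (x' x0 *\<^sub>R x0 + x' a *\<^sub>R a), x0' + x')"
    by (simp add: q_def tau At_def A_def)
  ultimately show thesis using that by metis
qed

section \<open>Maximality of the contact set\<close>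

text \<open>Points outside the effective domain contribute minus infinity to the supremum, and on
  the domain \<open>n\<close> vanishes.\<close>

lemma Jconj_add_annihilator:
  assumes "\<And>y. y \<in> PrX (effdom h) \<Longrightarrow> blinfun_apply n y = 0"
  shows "Jconj h (x, x' + n) = Jconj h (x, x')"
  unfolding Jconj_def
proof (rule SUP_cong)
  fix q
  show "ereal (blinfun_apply (snd (x, x' + n)) (fst q) + blinfun_apply (snd q) (fst (x, x' + n))) - h q
      = ereal (blinfun_apply (snd (x, x')) (fst q) + blinfun_apply (snd q) (fst (x, x'))) - h q"
  proof (cases "h q < \<infinity>")
    case True
    then have "fst q \<in> PrX (effdom h)"
      by (auto simp: PrX_def effdom_def intro!: exI[of _ "snd q"])
    then show ?thesis using assms by (simp add: blinfun.bilinear_simps)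
  qed simp
qed simp

theorem theorem3p1:
  fixes h :: "('a::banach) pt \<Rightarrow> ereal"
  assumes "proper_fun h"
    and "convex_fun h"
    and "\<forall>p. h p \<ge> ereal (pairing p)"
    and "\<forall>p. Jconj h p \<ge> ereal (pairing p)"
    and "closed (\<Union>c\<in>{0::real<..}. (\<lambda>x. c *\<^sub>R x) ` PrX (effdom h))"
    and "subspace (\<Union>c\<in>{0::real<..}. (\<lambda>x. c *\<^sub>R x) ` PrX (effdom h))"
  shows "maximal_monotone {p. Jconj h p = ereal (pairing p)}
       \<and> Jconj h \<in> fitzpatrick_family {p. Jconj h p = ereal (pairing p)}"
proof -
  define V where "V = (\<Union>c\<in>{0::real<..}. (\<lambda>x. c *\<^sub>R x) ` PrX (effdom h))"
  define T where "T = {p. Jconj h p = ereal (pairing p)}"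
  note h = assms(3) and J = assms(4)
  have V: "closed V" "subspace V" using assms(5,6) by (auto simp: V_def)
  have DV: "PrX (effdom h) \<subseteq> V"
    unfolding V_def by (force intro: bexI[of _ 1])
  have absorb: "\<exists>c>0. c *\<^sub>R v \<in> PrX (effdom h)" if v: "v \<in> V" for v
  proof -
    obtain c x where c: "c > 0" "x \<in> PrX (effdom h)" "v = c *\<^sub>R x" using v by (auto simp: V_def)
    then have "inverse c *\<^sub>R v = x" by simp
    then show ?thesis using c by (intro exI[of _ "inverse c"]) auto
  qed
  note contact = contact_point_near[OF assms(2) h J V DV absorb]
  have mono: "monotone_op T"
    unfolding T_def by (rule monotone_contact_set[OF Jconj_convex[OF h] J])
  have in_T: "(x0, x0') \<in> T"
    if related: "\<And>x x'. (x, x') \<in> T \<Longrightarrow> blinfun_apply (x0' - x') (x0 - x) \<ge> 0" for x0 x0'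
  proof -
    have x0: "x0 \<in> V"
    proof (rule ccontr)
      assume "x0 \<notin> V"
      then obtain n :: "'a \<Rightarrow>\<^sub>L real" where n: "\<And>v. v \<in> V \<Longrightarrow> n v = 0" "n x0 \<noteq> 0"
        using separate_point_subspace[OF V] by blast
      obtain x' where x': "(0, x') \<in> T"
        using contact[of 0 0 0] V(2) by (auto simp: subspace_0 T_def)
      \<comment> \<open>Chosen so that the pairing tested against relatedness becomes
        \<open>-1\<close>.\<close>
      define c where "c = ((x0' - x') x0 + 1) / n x0"
      have "(0, x' + c *\<^sub>R n) \<in> T"
        using x' Jconj_add_annihilator[of h "c *\<^sub>R n" 0 x'] n(1) DV
        by (auto simp: T_def pairing_def blinfun.bilinear_simps)
      then have "0 \<le> (x0' - (x' + c *\<^sub>R n)) (x0 - 0)" by (rule related)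
      then show False using n(2) by (simp add: c_def blinfun.bilinear_simps)
    qed
    have "Jconj h (x0, x0') \<le> ereal (pairing (x0, x0'))"
      unfolding Jconj_le_iff[OF h]
    proof (intro allI impI)
      fix y y' t assume y: "h (y, y') \<le> ereal t"
      then have "y \<in> PrX (effdom h)"
        by (auto simp: PrX_def effdom_def intro!: exI[of _ y'] order.strict_trans1)
      then have "y \<in> V" using DV by blast
      then obtain x' :: "'a \<Rightarrow>\<^sub>L real" where x': "(x0 - (x' x0 *\<^sub>R x0 + x' y *\<^sub>R y), x0' + x') \<in> T"
        using contact[OF _ x0] by (auto simp: T_def)
      \<comment> \<open>The two differences are \<open>- x'\<close> and
        \<open>x' x0 *\<^sub>R x0 + x' y *\<^sub>R y\<close>.\<close>
      have "0 \<le> - (x' x0)\<^sup>2 - (x' y)\<^sup>2"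
        using related[OF x'] by (simp add: blinfun.bilinear_simps power2_eq_square)
      then have "(x' x0)\<^sup>2 = 0 \<and> (x' y)\<^sup>2 = 0"
        using zero_le_power2[of "x' x0"] zero_le_power2[of "x' y"] by linarith
      then have zero: "x' x0 = 0" "x' y = 0" by auto
      then have "Jconj h (x0, x0' + x') \<le> ereal (pairing (x0, x0' + x'))"
        using x' by (simp add: T_def)
      \<comment> \<open>Since \<open>x'\<close> vanishes at both \<open>y\<close> and
        \<open>x0\<close>, it drops out of both sides of the inequality for
        \<open>(x0, x0' + x')\<close>.\<close>
      then show "blinfun_apply (snd (x0, x0')) y + blinfun_apply y' (fst (x0, x0')) - t \<le> pairing (x0, x0')"
        using y zero unfolding Jconj_le_iff[OF h]
        by (fastforce simp: pairing_def blinfun.bilinear_simps)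
    qed
    then show ?thesis using J by (simp add: T_def antisym)
  qed
  have "S = T" if S: "monotone_op S" "T \<subseteq> S" for S
  proof
    show "S \<subseteq> T"
    proof
      fix p assume p: "p \<in> S"
      obtain x0 x0' where p_eq: "p = (x0, x0')" by force
      have "(x0, x0') \<in> T"
        by (rule in_T) (use S p in \<open>fastforce simp: p_eq monotone_op_def\<close>)
      then show "p \<in> T" by (simp add: p_eq)
    qed
  qed (rule S)
  then have "maximal_monotone T" using mono by (auto simp: maximal_monotone_def)
  moreover have "Jconj h \<in> fitzpatrick_family T"
    using Jconj_convex[OF h] Jconj_lsc[OF h J] J by (simp add: fitzpatrick_family_def T_def)
  ultimately show ?thesis by (simp add: T_def)
qed

end
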